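(* Let $\mathbb{K}=\mathbb{R}$ or $\mathbb{C}$, let $\rho>0$, and let $B_\rho$ be the Banach algebra of power series $f=\sum_{k\in\mathbb{N}}a_kx^k$ in one variable $x$ over $\mathbb{K}$ with $\|f\|_\rho:=\sum_k|a_k|\rho^k<\infty$. Set $$F(x,t,y_1,y_2):=xy_1^2-(x+t)y_2^2\in B_\rho\{t\}[y_1,y_2].$$ Let $\sqrt{1+t}=1+\sum_{n\ge1}a_nt^n\in\mathbb{Q}[[t]]$ be the unique power series with constant term $1$ whose square is $1+t$, and for $c\in\mathbb{N}$ set $y_2^{(c)}(t):=x^c$ and $y_1^{(c)}(t):=x^c+\sum_{n=1}^ca_nx^{c-n}t^n$ in $B_\rho\{t\}$. Then: (1) for every $c\in\mathbb{N}$, $F(x,t,y_1^{(c)}(t),y_2^{(c)}(t))\in(t)^{c+1}$; (2) the only solution $(y_1(t),y_2(t))\in B_\rho\{t\}^2$ of $F(x,t,y_1(t),y_2(t))=0$ is $(0,0)$; (3) consequently, there is no function $\beta:\mathbb{N}\to\mathbb{N}$ such that for every $y(t)\in B_\rho\{t\}^2$ and every $k\in\mathbb{N}$ with $F(x,t,y(t))\in(t)^{\beta(k)}$ there exists $\widetilde{y}(t)\in B_\rho\{t\}^2$ with $F(x,t,\widetilde{y}(t))=0$ and $\widetilde{y}(t)-y(t)\in(t)^k$ (componentwise).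
   Context: For a Banach algebra $B$ with norm $\|\cdot\|$, $B\{t\}$ denotes the ring of convergent power series in $t$ over $B$: series $\sum_k f_kt^k$ with $f_k\in B$ such that $\sum_k\|f_k\|\tau^k<\infty$ for some real $\tau>0$. Here $(t)^k$ denotes the $k$-th power of the ideal of $B_\rho\{t\}$ generated by $t$. $\mathbb{N}$ includes $0$. *)

theory Defs
  imports
    "HOL-Analysis.Analysis"
    "HOL-Computational_Algebra.Formal_Power_Series"
    "HOL-Algebra.Ideal_Product"
begin

unbundle fps_syntax

text \<open>
  The base field is a type of class \<open>real_normed_field\<close> and \<open>banach\<close>. The library instances are
  \<open>real\<close> and \<open>complex\<close>, and by the Gelfand--Mazur theorem there are no others up to isometric
  isomorphism.
\<close>

definition Brho :: "real \<Rightarrow> 'k::{real_normed_field,banach} fps set"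
  where "Brho \<rho> = {f. summable (\<lambda>k. norm (f $ k) * \<rho> ^ k)}"

definition Brho_norm :: "real \<Rightarrow> 'k::{real_normed_field,banach} fps \<Rightarrow> real"
  where "Brho_norm \<rho> f = (\<Sum>k. norm (f $ k) * \<rho> ^ k)"

text \<open>The set \<open>B{t}\<close>, for a Banach algebra with carrier \<open>B\<close> and norm \<open>nrm\<close>.\<close>

definition convergent_fps :: "'b::zero set \<Rightarrow> ('b \<Rightarrow> real) \<Rightarrow> 'b fps set"
  where "convergent_fps B nrm =
    {f. (\<forall>k. f $ k \<in> B) \<and> (\<exists>\<tau>>0. summable (\<lambda>k. nrm (f $ k) * \<tau> ^ k))}"

text \<open>Elements of \<open>B\<^sub>\<rho>{t}\<close> have type \<open>'k fps fps\<close>: the outer variable is \<open>t\<close>, the inner one \<open>x\<close>.\<close>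

definition Brho_t :: "real \<Rightarrow> 'k::{real_normed_field,banach} fps fps ring"
  where "Brho_t \<rho> =
    \<lparr>carrier = convergent_fps (Brho \<rho>) (Brho_norm \<rho>), mult = (*), one = 1, zero = 0, add = (+)\<rparr>"

abbreviation var_t :: "'k::{real_normed_field,banach} fps fps"
  where "var_t \<equiv> fps_X"

abbreviation var_x :: "'k::{real_normed_field,banach} fps fps"
  where "var_x \<equiv> fps_const fps_X"

text \<open>
  The ideal \<open>(t)\<^sup>k\<close> of \<open>B\<^sub>\<rho>{t}\<close>, as a power in the library's monoid of ideals, whose product is the
  ideal product and whose unit is the whole ring.
\<close>

definition t_ideal_pow :: "real \<Rightarrow> nat \<Rightarrow> 'k::{real_normed_field,banach} fps fps set"
  where "t_ideal_pow \<rho> k = (Idl\<^bsub>Brho_t \<rho>\<^esub> {var_t}) [^]\<^bsub>ideals_set (Brho_t \<rho>)\<^esub> k"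

text \<open>The polynomial \<open>F(x, t, y\<^sub>1, y\<^sub>2)\<close>, as a function of the values substituted for \<open>y\<^sub>1, y\<^sub>2\<close>.\<close>

definition F :: "'k::{real_normed_field,banach} fps fps \<Rightarrow> 'k fps fps \<Rightarrow> 'k fps fps"
  where "F y1 y2 = var_x * y1\<^sup>2 - (var_x + var_t) * y2\<^sup>2"

definition sqrt_one_plus_t :: "rat fps"
  where "sqrt_one_plus_t = (THE s. s $ 0 = 1 \<and> s\<^sup>2 = 1 + fps_X)"

definition approx1 :: "nat \<Rightarrow> 'k::{real_normed_field,banach} fps fps"
  where "approx1 c = var_x ^ c +
    (\<Sum>n=1..c. fps_const (fps_const (of_rat (sqrt_one_plus_t $ n))) * var_x ^ (c - n) * var_t ^ n)"

definition approx2 :: "nat \<Rightarrow> 'k::{real_normed_field,banach} fps fps"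
  where "approx2 c = var_x ^ c"

lemma sqrt_one_plus_t_ex1: "\<exists>!s :: rat fps. s $ 0 = 1 \<and> s\<^sup>2 = 1 + fps_X"
proof (rule ex1I)
  show "fps_binomial (1/2) $ 0 = (1::rat) \<and> (fps_binomial (1/2))\<^sup>2 = 1 + (fps_X :: rat fps)"
    by (simp add: fps_binomial_power fps_binomial_1)
next
  fix s :: "rat fps" assume s: "s $ 0 = 1 \<and> s\<^sup>2 = 1 + fps_X"
  have "s\<^sup>2 = (fps_binomial (1/2))\<^sup>2"
    using s by (simp add: fps_binomial_power fps_binomial_1)
  then have "s = fps_binomial (1/2) \<or> s = - fps_binomial (1/2)"
    by (simp add: power2_eq_iff)
  then show "s = fps_binomial (1/2)" using s by auto
qed

text \<open>
  Since \<open>Idl\<close> and \<open>ideals_set\<close> are meaningful only over a ring, we check that \<open>B\<^sub>\<rho>{t}\<close> is one.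
\<close>

lemma weighted_mult_summable:
  fixes f g :: "'b::comm_ring_1 fps" and N :: "'b \<Rightarrow> real"
  assumes nonneg: "\<And>a. a \<in> B \<Longrightarrow> N a \<ge> 0"
    and sub: "\<And>a b. a \<in> B \<Longrightarrow> b \<in> B \<Longrightarrow> a * b \<in> B \<and> N (a * b) \<le> N a * N b"
    and tri: "\<And>a b. a \<in> B \<Longrightarrow> b \<in> B \<Longrightarrow> a + b \<in> B \<and> N (a + b) \<le> N a + N b"
    and zero: "0 \<in> B" "N 0 = 0"
    and f: "\<And>k. f $ k \<in> B" "summable (\<lambda>k. N (f $ k) * r ^ k)"
    and g: "\<And>k. g $ k \<in> B" "summable (\<lambda>k. N (g $ k) * r ^ k)"
    and r: "r > 0"
  shows "(f * g) $ k \<in> B"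
    and "summable (\<lambda>k. N ((f * g) $ k) * r ^ k)"
    and "(\<Sum>k. N ((f * g) $ k) * r ^ k) \<le> (\<Sum>k. N (f $ k) * r ^ k) * (\<Sum>k. N (g $ k) * r ^ k)"
proof -
  have sum_B: "sum h A \<in> B \<and> N (sum h A) \<le> (\<Sum>i\<in>A. N (h i))"
    if "finite A" "\<And>i. i \<in> A \<Longrightarrow> h i \<in> B" for h :: "nat \<Rightarrow> 'b" and A
    using that
  proof (induction A rule: finite_induct)
    case empty then show ?case using zero by simp
  next
    case (insert a A)
    then show ?case using tri[of "h a" "sum h A"] by fastforce
  qed
  let ?a = "\<lambda>k. N (f $ k) * r ^ k" and ?b = "\<lambda>k. N (g $ k) * r ^ k"
  have na: "\<And>k. ?a k \<ge> 0" and nb: "\<And>k. ?b k \<ge> 0" using nonneg f g r by simp_all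
  have sa: "summable (\<lambda>k. norm (?a k))" and sb: "summable (\<lambda>k. norm (?b k))"
    using f g na nb by simp_all
  have B: "(f * g) $ k \<in> B" for k
    unfolding fps_mult_nth using sum_B sub f g by simp
  then show "(f * g) $ k \<in> B" .
  have le: "N ((f * g) $ k) * r ^ k \<le> (\<Sum>i\<le>k. ?a i * ?b (k - i))" for k
  proof -
    have "N ((f * g) $ k) \<le> (\<Sum>i\<in>{0..k}. N (f $ i * g $ (k - i)))"
      unfolding fps_mult_nth using sum_B sub f g by simp
    also have "\<dots> \<le> (\<Sum>i\<in>{0..k}. N (f $ i) * N (g $ (k - i)))"
      by (intro sum_mono) (use sub f g in simp)
    finally have "N ((f * g) $ k) * r ^ k \<le> (\<Sum>i\<in>{0..k}. N (f $ i) * N (g $ (k - i))) * r ^ k"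
      using r by (intro mult_right_mono) auto
    also have "\<dots> = (\<Sum>i\<le>k. ?a i * ?b (k - i))"
      unfolding sum_distrib_right atLeast0AtMost
    proof (rule sum.cong)
      fix i assume "i \<in> {..k}"
      then have "r ^ k = r ^ i * r ^ (k - i)" by (simp flip: power_add)
      then show "N (f $ i) * N (g $ (k - i)) * r ^ k = ?a i * ?b (k - i)" by simp
    qed simp
    finally show ?thesis .
  qed
  have S: "summable (\<lambda>k. \<Sum>i\<le>k. ?a i * ?b (k - i))"
    using summable_Cauchy_product[OF sa sb] .
  show S': "summable (\<lambda>k. N ((f * g) $ k) * r ^ k)"
    by (rule summable_comparison_test'[OF S, of 0]) (use le B nonneg r in simp)
  show "(\<Sum>k. N ((f * g) $ k) * r ^ k) \<le> (\<Sum>k. N (f $ k) * r ^ k) * (\<Sum>k. N (g $ k) * r ^ k)"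
    using suminf_le[OF le S' S] Cauchy_product[OF sa sb] by simp
qed

lemma Brho_norm_nonneg: "f \<in> Brho \<rho> \<Longrightarrow> \<rho> > 0 \<Longrightarrow> Brho_norm \<rho> f \<ge> 0"
  unfolding Brho_norm_def Brho_def by (intro suminf_nonneg) auto

lemma Brho_norm_mult:
  assumes "f \<in> Brho \<rho>" "g \<in> Brho \<rho>" "\<rho> > 0"
  shows "f * g \<in> Brho \<rho> \<and> Brho_norm \<rho> (f * g) \<le> Brho_norm \<rho> f * Brho_norm \<rho> g"
  using weighted_mult_summable[of UNIV norm f \<rho> g] assms
  by (auto simp: Brho_def Brho_norm_def norm_mult norm_triangle_ineq)

lemma Brho_norm_add:
  assumes "f \<in> Brho \<rho>" "g \<in> Brho \<rho>" "\<rho> > 0"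
  shows "f + g \<in> Brho \<rho> \<and> Brho_norm \<rho> (f + g) \<le> Brho_norm \<rho> f + Brho_norm \<rho> g"
proof -
  have S: "summable (\<lambda>k. norm (f $ k) * \<rho> ^ k + norm (g $ k) * \<rho> ^ k)"
    using assms by (auto simp: Brho_def intro: summable_add)
  have le: "norm ((f + g) $ k) * \<rho> ^ k \<le> norm (f $ k) * \<rho> ^ k + norm (g $ k) * \<rho> ^ k" for k
    using mult_right_mono[OF norm_triangle_ineq[of "f $ k" "g $ k"], of "\<rho> ^ k"] assms
    by (simp add: distrib_right)
  have S': "summable (\<lambda>k. norm ((f + g) $ k) * \<rho> ^ k)"
    by (rule summable_comparison_test'[OF S, of 0]) (use le assms in simp)
  show ?thesis
    using suminf_le[OF le S' S] S' assms
    by (simp add: Brho_def Brho_norm_def flip: suminf_add)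
qed

lemma Brho_uminus: "f \<in> Brho \<rho> \<Longrightarrow> - f \<in> Brho \<rho>"
  by (simp add: Brho_def)

lemma Brho_norm_uminus: "Brho_norm \<rho> (- f) = Brho_norm \<rho> f"
  by (simp add: Brho_norm_def)

lemma Brho_0: "0 \<in> Brho \<rho>" and Brho_norm_0: "Brho_norm \<rho> 0 = 0"
  by (simp_all add: Brho_def Brho_norm_def)

lemma Brho_1: "1 \<in> Brho \<rho>"
  unfolding Brho_def mem_Collect_eq by (rule summable_finite[of "{0}"]) auto

lemma convergent_fps_common_radius:
  fixes f g :: "'k::{real_normed_field,banach} fps fps"
  assumes "\<rho> > 0" "f \<in> convergent_fps (Brho \<rho>) (Brho_norm \<rho>)"
    "g \<in> convergent_fps (Brho \<rho>) (Brho_norm \<rho>)"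
  obtains \<tau> where "\<tau> > 0" "summable (\<lambda>k. Brho_norm \<rho> (f $ k) * \<tau> ^ k)"
    "summable (\<lambda>k. Brho_norm \<rho> (g $ k) * \<tau> ^ k)"
proof -
  have *: "summable (\<lambda>k. Brho_norm \<rho> (h $ k) * \<tau> ^ k)"
    if S: "summable (\<lambda>k. Brho_norm \<rho> (h $ k) * \<sigma> ^ k)" and "0 < \<tau>" "\<tau> \<le> \<sigma>"
      and "h \<in> convergent_fps (Brho \<rho>) (Brho_norm \<rho>)" for h :: "'k fps fps" and \<sigma> \<tau> :: real
    by (rule summable_comparison_test'[OF S, of 0])
      (use that assms(1) in \<open>auto simp: convergent_fps_def Brho_norm_nonneg intro!: mult_left_mono power_mono\<close>)
  from assms obtain \<tau>1 \<tau>2 where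
    "\<tau>1 > 0" "summable (\<lambda>k. Brho_norm \<rho> (f $ k) * \<tau>1 ^ k)"
    "\<tau>2 > 0" "summable (\<lambda>k. Brho_norm \<rho> (g $ k) * \<tau>2 ^ k)"
    unfolding convergent_fps_def by blast
  then show ?thesis
    using that[of "min \<tau>1 \<tau>2"] *[of f \<tau>1 "min \<tau>1 \<tau>2"] *[of g \<tau>2 "min \<tau>1 \<tau>2"] assms by simp
qed

lemma Brho_t_mult_closed:
  assumes "\<rho> > 0" "f \<in> carrier (Brho_t \<rho>)" "g \<in> carrier (Brho_t \<rho>)"
  shows "f * g \<in> carrier (Brho_t \<rho>)"
proof -
  have fg: "f \<in> convergent_fps (Brho \<rho>) (Brho_norm \<rho>)" "g \<in> convergent_fps (Brho \<rho>) (Brho_norm \<rho>)"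
    using assms by (auto simp: Brho_t_def)
  obtain \<tau> where \<tau>: "\<tau> > 0" "summable (\<lambda>k. Brho_norm \<rho> (f $ k) * \<tau> ^ k)"
    "summable (\<lambda>k. Brho_norm \<rho> (g $ k) * \<tau> ^ k)"
    using convergent_fps_common_radius[OF assms(1) fg] .
  have c: "\<And>k. f $ k \<in> Brho \<rho>" "\<And>k. g $ k \<in> Brho \<rho>" using fg by (auto simp: convergent_fps_def)
  note W = weighted_mult_summable[of "Brho \<rho>" "Brho_norm \<rho>" f \<tau> g,
      OF Brho_norm_nonneg[OF _ assms(1)] Brho_norm_mult[OF _ _ assms(1)]
        Brho_norm_add[OF _ _ assms(1)] Brho_0 Brho_norm_0 c(1) \<tau>(2) c(2) \<tau>(3) \<tau>(1)]
  show ?thesis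
    using W(1,2) \<tau>(1) by (auto simp: Brho_t_def convergent_fps_def)
qed

lemma Brho_t_add_closed:
  assumes "\<rho> > 0" "f \<in> carrier (Brho_t \<rho>)" "g \<in> carrier (Brho_t \<rho>)"
  shows "f + g \<in> carrier (Brho_t \<rho>)"
proof -
  have fg: "f \<in> convergent_fps (Brho \<rho>) (Brho_norm \<rho>)" "g \<in> convergent_fps (Brho \<rho>) (Brho_norm \<rho>)"
    using assms by (auto simp: Brho_t_def)
  obtain \<tau> where \<tau>: "\<tau> > 0" "summable (\<lambda>k. Brho_norm \<rho> (f $ k) * \<tau> ^ k)"
    "summable (\<lambda>k. Brho_norm \<rho> (g $ k) * \<tau> ^ k)"
    using convergent_fps_common_radius[OF assms(1) fg] .
  have c: "\<And>k. f $ k \<in> Brho \<rho>" "\<And>k. g $ k \<in> Brho \<rho>" using fg by (auto simp: convergent_fps_def)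
  have fgk: "f $ k + g $ k \<in> Brho \<rho>"
    "Brho_norm \<rho> (f $ k + g $ k) \<le> Brho_norm \<rho> (f $ k) + Brho_norm \<rho> (g $ k)" for k
    using Brho_norm_add[OF c(1)[of k] c(2)[of k] assms(1)] by auto
  have "Brho_norm \<rho> (f $ k + g $ k) * \<tau> ^ k
      \<le> Brho_norm \<rho> (f $ k) * \<tau> ^ k + Brho_norm \<rho> (g $ k) * \<tau> ^ k" for k
    using mult_right_mono[OF fgk(2)[of k], of "\<tau> ^ k"] \<tau>(1) by (simp add: distrib_right)
  then have "summable (\<lambda>k. Brho_norm \<rho> (f $ k + g $ k) * \<tau> ^ k)"
    by (intro summable_comparison_test'[OF summable_add[OF \<tau>(2,3)], of 0])
      (use Brho_norm_nonneg[OF fgk(1) assms(1)] \<tau>(1) in simp)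
  then show ?thesis
    using fgk(1) \<tau>(1) by (auto simp: Brho_t_def convergent_fps_def)
qed

lemma cring_Brho_t:
  assumes "\<rho> > 0"
  shows "cring (Brho_t \<rho> :: 'k::{real_normed_field,banach} fps fps ring)"
proof (rule cringI)
  have minus: "- f \<in> carrier (Brho_t \<rho>)" if "f \<in> carrier (Brho_t \<rho>)" for f :: "'k fps fps"
    using that by (auto simp: Brho_t_def convergent_fps_def Brho_uminus Brho_norm_uminus)
  have zero: "(0 :: 'k fps fps) \<in> carrier (Brho_t \<rho>)"
    by (auto simp: Brho_t_def convergent_fps_def Brho_0 Brho_norm_0 intro!: exI[of _ 1])
  have one: "(1 :: 'k fps fps) \<in> carrier (Brho_t \<rho>)"
  proof -
    have "summable (\<lambda>k. Brho_norm \<rho> ((1 :: 'k fps fps) $ k) * 1 ^ k)"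
      by (rule summable_finite[of "{0}"]) (simp_all add: Brho_norm_0)
    moreover have "\<forall>k. (1 :: 'k fps fps) $ k \<in> Brho \<rho>"
      by (simp add: Brho_0 Brho_1)
    ultimately show ?thesis
      by (auto simp: Brho_t_def convergent_fps_def simp del: fps_one_nth intro!: exI[of _ 1])
  qed
  note add = Brho_t_add_closed[OF assms]
  show "abelian_group (Brho_t \<rho> :: 'k fps fps ring)"
  proof (rule abelian_groupI)
    fix f :: "'k fps fps" assume "f \<in> carrier (Brho_t \<rho>)"
    then show "\<exists>h\<in>carrier (Brho_t \<rho>). h \<oplus>\<^bsub>Brho_t \<rho>\<^esub> f = \<zero>\<^bsub>Brho_t \<rho>\<^esub>"
      by (intro bexI[of _ "- f"] minus) (simp add: Brho_t_def)
  qed (use add zero in \<open>auto simp: Brho_t_def algebra_simps\<close>)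
  show "comm_monoid (Brho_t \<rho> :: 'k fps fps ring)"
    by (rule comm_monoidI)
      (use Brho_t_mult_closed[OF assms] one in \<open>auto simp: Brho_t_def algebra_simps\<close>)
qed (auto simp: Brho_t_def algebra_simps)

end

theory Submission
  imports Defs
begin

unbundle no vec_syntax

text \<open>
  Exchanging \<open>x\<close> and \<open>t\<close> shows that a nonzero solution of \<open>x y\<^sub>1\<^sup>2 = (x + t) y\<^sub>2\<^sup>2\<close> is impossible for
  parity reasons, already over the formal power series: the \<open>x\<close>-adic order of the left-hand side is
  odd, and that of the right-hand side is even. On the other hand \<open>y\<^sub>1\<^sup>(\<^sup>c\<^sup>)\<close> is the truncation at
  order \<open>c\<close> of the expansion of \<open>x\<^sup>c (1 + t/x)\<^sup>1\<^sup>/\<^sup>2\<close>, which has a pole in \<open>x\<close> only beyond order \<open>c\<close>;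
  so there are approximate solutions of every order with \<open>y\<^sub>2 = x\<^sup>c\<close>, which is never divisible by
  \<open>t\<close>.
\<close>

section \<open>Membership in the ring of convergent series\<close>

lemma carrier_Brho_t_iff:
  "f \<in> carrier (Brho_t \<rho>) \<longleftrightarrow>
    (\<forall>k. f $ k \<in> Brho \<rho>) \<and> (\<exists>\<tau>>0. summable (\<lambda>k. Brho_norm \<rho> (f $ k) * \<tau> ^ k))"
  by (simp add: Brho_t_def convergent_fps_def)

lemma Brho_t_simps [simp]:
  "mult (Brho_t \<rho>) = (*)" "one (Brho_t \<rho>) = 1" "zero (Brho_t \<rho>) = 0" "add (Brho_t \<rho>) = (+)"
  by (simp_all add: Brho_t_def)

lemma Brho_t_finite_support:
  assumes "finite A" "\<And>k. f $ k \<in> Brho \<rho>" "\<And>k. k \<notin> A \<Longrightarrow> f $ k = 0"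
  shows "f \<in> carrier (Brho_t \<rho>)"
proof -
  have "summable (\<lambda>k. Brho_norm \<rho> (f $ k) * 1 ^ k)"
    by (rule summable_finite[OF assms(1)]) (simp add: assms(3) Brho_norm_0)
  then show ?thesis
    using assms(2) by (auto simp: carrier_Brho_t_iff intro!: exI[of _ 1])
qed

lemma Brho_finite_support:
  assumes "finite A" "\<And>k. k \<notin> A \<Longrightarrow> f $ k = 0"
  shows "f \<in> Brho \<rho>"
  unfolding Brho_def mem_Collect_eq using assms by (intro summable_finite[of A]) auto

lemma const_mult_X_power_in_Brho: "fps_const a * fps_X ^ n \<in> Brho \<rho>"
  by (rule Brho_finite_support[of "{n}"]) auto

lemma X_power_in_Brho: "fps_X ^ n \<in> Brho \<rho>"
  by (rule Brho_finite_support[of "{n}"]) auto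

text \<open>Dropping the first \<open>n\<close> coefficients leaves a tail of the same summable
  series, rescaled by the inverse of \<open>\<tau> ^ n\<close>, so the radius \<open>\<tau>\<close>
  still works. This is what makes division by a power of \<open>t\<close> possible without losing
  convergence.\<close>

lemma fps_shift_in_Brho_t:
  assumes "\<rho> > 0" "f \<in> carrier (Brho_t \<rho>)"
  shows "fps_shift n f \<in> carrier (Brho_t \<rho>)"
proof -
  obtain \<tau> where \<tau>: "\<tau> > 0" "summable (\<lambda>k. Brho_norm \<rho> (f $ k) * \<tau> ^ k)"
    using assms(2) by (auto simp: carrier_Brho_t_iff)
  have "summable (\<lambda>k. (Brho_norm \<rho> (f $ (k + n)) * \<tau> ^ (k + n)) * inverse (\<tau> ^ n))"
    using \<tau>(2) by (intro summable_mult2 summable_ignore_initial_segment)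
  also have "(\<lambda>k. (Brho_norm \<rho> (f $ (k + n)) * \<tau> ^ (k + n)) * inverse (\<tau> ^ n)) =
      (\<lambda>k. Brho_norm \<rho> (fps_shift n f $ k) * \<tau> ^ k)"
    using \<tau>(1) by (auto simp: power_add field_simps)
  finally show ?thesis
    using assms(2) \<tau>(1) by (auto simp: carrier_Brho_t_iff)
qed

section \<open>Powers of the ideal generated by \<open>t\<close>\<close>

lemma var_t_in_Brho_t: "var_t \<in> carrier (Brho_t \<rho>)"
  by (rule Brho_t_finite_support[of "{1}"]) (auto simp: Brho_0 Brho_1)

lemma genideal_var_t:
  assumes "\<rho> > 0"
  shows "Idl\<^bsub>Brho_t \<rho>\<^esub> {var_t :: 'k::{real_normed_field,banach} fps fps} =
    {f * var_t | f. f \<in> carrier (Brho_t \<rho>)}"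
  by (simp add: cgenideal_def flip: cring.cgenideal_eq_genideal[OF cring_Brho_t[OF assms] var_t_in_Brho_t])

text \<open>Turns every later question about ideal powers into one about low-order coefficients in
  \<open>t\<close>. The backward direction rests on the quotient by a power of \<open>t\<close>
  being convergent again.\<close>

lemma t_ideal_pow_iff:
  fixes f :: "'k::{real_normed_field,banach} fps fps"
  assumes "\<rho> > 0"
  shows "f \<in> t_ideal_pow \<rho> k \<longleftrightarrow> f \<in> carrier (Brho_t \<rho>) \<and> (\<forall>i<k. f $ i = 0)"
proof (induction k arbitrary: f)
  case 0
  then show ?case by (simp add: t_ideal_pow_def ideals_set_def)
next
  case (Suc k)
  let ?R = "Brho_t \<rho> :: 'k fps fps ring"
  have pow_Suc: "t_ideal_pow \<rho> (Suc k) = ideal_prod ?R (t_ideal_pow \<rho> k) (Idl\<^bsub>?R\<^esub> {var_t})"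
    by (simp add: t_ideal_pow_def ideals_set_def)
  show ?case
  proof
    assume "f \<in> t_ideal_pow \<rho> (Suc k)"
    then show "f \<in> carrier ?R \<and> (\<forall>i<Suc k. f $ i = 0)"
      unfolding pow_Suc
    proof (induction f rule: ideal_prod.induct)
      case (prod i j)
      then obtain g where g: "g \<in> carrier ?R" "j = g * var_t"
        by (auto simp: genideal_var_t[OF assms])
      have i: "i \<in> carrier ?R" "\<And>l. l < k \<Longrightarrow> i $ l = 0"
        using prod(1) Suc.IH by auto
      have "(i * g) $ l = 0" if "l < k" for l
        using that i(2) by (auto simp: fps_mult_nth intro!: sum.neutral)
      \<comment> \<open>The factor \<open>var_t\<close> shifts the coefficients up by one: index 0
        becomes zero, and index \<open>l\<close> inherits the vanishing at
        \<open>l - 1\<close>.\<close>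
      then have "(i * g * var_t) $ l = 0" if "l < Suc k" for l
        using that by (cases l) auto
      moreover have "i * g * var_t \<in> carrier ?R"
        by (intro Brho_t_mult_closed assms i g var_t_in_Brho_t)
      ultimately show ?case by (simp add: g mult.assoc)
    next
      case (sum s1 s2)
      then show ?case by (auto intro: Brho_t_add_closed[OF assms])
    qed
  next
    assume f: "f \<in> carrier ?R \<and> (\<forall>i<Suc k. f $ i = 0)"
    have "fps_shift (Suc k) f \<in> carrier ?R"
      using fps_shift_in_Brho_t[OF assms] f by blast
    moreover have "var_t ^ k \<in> carrier ?R"
      by (rule Brho_t_finite_support[of "{k}"]) (auto simp: Brho_0 Brho_1)
    \<comment> \<open>Write \<open>f\<close> as \<open>t^k * (f / t^(k+1)) * t\<close>: the
      induction hypothesis puts the first two factors in the \<open>k\<close>-th power, and the last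
      \<open>t\<close> supplies the ideal product.\<close>
    ultimately have "var_t ^ k * fps_shift (Suc k) f \<in> t_ideal_pow \<rho> k"
      by (simp add: Suc.IH Brho_t_mult_closed[OF assms] fps_X_power_mult_nth)
    moreover have "var_t \<in> Idl\<^bsub>?R\<^esub> {var_t}"
      using ring.genideal_self'[OF cring.axioms(1)[OF cring_Brho_t[OF assms]] var_t_in_Brho_t] .
    ultimately have "var_t ^ k * fps_shift (Suc k) f * var_t \<in> t_ideal_pow \<rho> (Suc k)"
      unfolding pow_Suc using ideal_prod.prod[of _ _ _ _ ?R] by force
    also have "var_t ^ k * fps_shift (Suc k) f * var_t = fps_X ^ Suc k * fps_shift (Suc k) f"
      by (simp add: ac_simps)
    also have "\<dots> = f"
      using f by (intro fps_ext) (auto simp: fps_X_power_mult_nth simp del: power_Suc)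
    finally show "f \<in> t_ideal_pow \<rho> (Suc k)" .
  qed
qed

section \<open>Exchange of the variables and uniqueness of the zero solution\<close>

definition swap_vars :: "'a::comm_ring_1 fps fps \<Rightarrow> 'a fps fps"
  where "swap_vars f = Abs_fps (\<lambda>m. Abs_fps (\<lambda>n. f $ n $ m))"

lemma swap_vars_nth [simp]: "swap_vars f $ m $ n = f $ n $ m"
  by (simp add: swap_vars_def)

lemma fps_fps_eq_iff: "f = g \<longleftrightarrow> (\<forall>m n. f $ m $ n = g $ m $ n)"
  by (simp add: fps_eq_iff)

lemma swap_vars_eq_0_iff [simp]: "swap_vars f = 0 \<longleftrightarrow> f = 0"
  by (auto simp: fps_fps_eq_iff)

lemma swap_vars_add: "swap_vars (f + g) = swap_vars f + swap_vars g"
  by (simp add: fps_fps_eq_iff)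

lemma swap_vars_mult: "swap_vars (f * g) = swap_vars f * swap_vars g"
proof -
  have "swap_vars (f * g) $ m $ n = (swap_vars f * swap_vars g) $ m $ n" for m n
    by (simp add: fps_mult_nth fps_sum_nth) (rule sum.swap)
  then show ?thesis by (simp add: fps_fps_eq_iff)
qed

lemma swap_vars_X: "swap_vars fps_X = fps_const fps_X"
  and swap_vars_const_X: "swap_vars (fps_const fps_X) = fps_X"
  by (auto simp: fps_fps_eq_iff)

lemma F_eq_0_iff:
  fixes y1 y2 :: "'k::{real_normed_field,banach} fps fps"
  shows "F y1 y2 = 0 \<longleftrightarrow> y1 = 0 \<and> y2 = 0"
proof
  assume "F y1 y2 = 0"
  \<comment> \<open>After the exchange \<open>x\<close> is the outer variable, so
    \<open>subdegree\<close> measures the order in \<open>x\<close>. Convergence plays no part: the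
    exchange lives in the formal series in both variables.\<close>
  define u v where "u = swap_vars y1" and "v = swap_vars y2"
  have "var_x * (y1 * y1) = (var_x + var_t) * (y2 * y2)"
    using \<open>F y1 y2 = 0\<close> by (simp add: F_def power2_eq_square)
  then have "swap_vars (var_x * (y1 * y1)) = swap_vars ((var_x + var_t) * (y2 * y2))"
    by simp
  then have eq: "fps_X * (u * u) = (fps_X + fps_const fps_X) * (v * v)"
    by (simp add: swap_vars_mult swap_vars_add swap_vars_X swap_vars_const_X u_def v_def)
  \<comment> \<open>At \<open>x = 0\<close> the factor \<open>x + t\<close> becomes
    \<open>t\<close>, which is nonzero, so its order in \<open>x\<close> is 0.\<close>
  let ?d = "fps_X + fps_const fps_X :: 'k fps fps"
  have d: "?d $ 0 \<noteq> 0" by simp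
  then have d0: "?d \<noteq> 0" "subdegree ?d = 0" by (metis fps_zero_nth, simp)
  have "u = 0 \<longleftrightarrow> v = 0"
    using arg_cong[OF eq, of "\<lambda>w. w = 0"] d0(1) by simp
  moreover have False if "u \<noteq> 0" "v \<noteq> 0"
  proof -
    have "2 * subdegree u + 1 = 2 * subdegree v"
      using arg_cong[OF eq, of subdegree] that d0 by simp
    then show False by presburger
  qed
  ultimately have "u = 0" "v = 0" by auto
  then show "y1 = 0 \<and> y2 = 0" by (simp add: u_def v_def)
qed (simp add: F_def)

section \<open>The approximate solutions\<close>

lemma sqrt_one_plus_t: "sqrt_one_plus_t $ 0 = 1" "sqrt_one_plus_t\<^sup>2 = 1 + fps_X"
  using theI'[OF sqrt_one_plus_t_ex1] by (simp_all add: sqrt_one_plus_t_def)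

text \<open>The separate leading term \<open>x^c\<close> fits the general formula at
  \<open>m = 0\<close> because the square root has constant term 1.\<close>

lemma approx1_nth:
  "approx1 c $ m = (if m \<le> c then fps_const (of_rat (sqrt_one_plus_t $ m)) * fps_X ^ (c - m) else 0)"
proof -
  have "approx1 c $ m = (fps_X ^ c * (if m = 0 then 1 else 0)) +
      (\<Sum>n=1..c. if m = n then fps_const (of_rat (sqrt_one_plus_t $ n)) * fps_X ^ (c - n) else 0)"
    by (simp add: approx1_def fps_sum_nth mult.assoc if_distrib cong: if_cong)
  then show ?thesis
    by (cases "m = 0") (auto simp: sum.delta sqrt_one_plus_t(1))
qed

lemma approx1_in_Brho_t: "approx1 c \<in> carrier (Brho_t \<rho>)"
  by (rule Brho_t_finite_support[of "{..c}"])
    (auto simp: approx1_nth Brho_0 const_mult_X_power_in_Brho)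

lemma approx2_in_Brho_t: "approx2 c \<in> carrier (Brho_t \<rho>)"
  by (rule Brho_t_finite_support[of "{0}"]) (auto simp: approx2_def Brho_0 X_power_in_Brho)

lemma fps_const_sum_distrib: "fps_const (sum h A) = (\<Sum>i\<in>A. fps_const (h i))"
  by (rule fps_ext) (simp add: fps_sum_nth)

text \<open>The coefficient of index \<open>m\<close> in the Cauchy product involves only indices up
  to \<open>m\<close>, hence up to \<open>c\<close>, so the truncation is invisible and the result
  is that of \<open>x^(2c) * (1 + t/x)\<close>.\<close>

lemma approx1_square_nth:
  assumes "m \<le> c"
  shows "(approx1 c :: 'k::{real_normed_field,banach} fps fps)\<^sup>2 $ m =
    fps_const (of_rat ((1 + fps_X :: rat fps) $ m)) * fps_X ^ (2 * c - m)"
proof -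
  let ?a = "\<lambda>n. sqrt_one_plus_t $ n"
  have "(approx1 c :: 'k fps fps)\<^sup>2 $ m =
      (\<Sum>i=0..m. fps_const (of_rat (?a i * ?a (m - i))) * fps_X ^ (2 * c - m))"
    unfolding power2_eq_square fps_mult_nth
  proof (rule sum.cong)
    fix i assume i: "i \<in> {0..m}"
    then have "(fps_X :: 'k fps) ^ (2 * c - m) = fps_X ^ (c - i) * fps_X ^ (c - (m - i))"
      using assms by (simp flip: power_add)
    moreover have "approx1 c $ i * approx1 c $ (m - i) =
        fps_const (of_rat (?a i * ?a (m - i)) :: 'k) * (fps_X ^ (c - i) * fps_X ^ (c - (m - i)))"
      using i assms by (simp add: approx1_nth of_rat_mult mult_ac flip: fps_const_mult)
    ultimately show "approx1 c $ i * approx1 c $ (m - i) =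
        fps_const (of_rat (?a i * ?a (m - i)) :: 'k) * fps_X ^ (2 * c - m)"
      by (simp only:)
  qed simp
  also have "\<dots> = fps_const (of_rat (\<Sum>i=0..m. ?a i * ?a (m - i))) * fps_X ^ (2 * c - m)"
    by (simp add: of_rat_sum fps_const_sum_distrib flip: sum_distrib_right)
  also have "(\<Sum>i=0..m. ?a i * ?a (m - i)) = (1 + fps_X) $ m"
    by (metis fps_mult_nth power2_eq_square sqrt_one_plus_t(2))
  finally show ?thesis .
qed

lemma F_approx_nth:
  assumes "m \<le> c"
  shows "F (approx1 c) (approx2 c) $ m = 0"
proof -
  have "F (approx1 c) (approx2 c) $ m =
      fps_X * (approx1 c)\<^sup>2 $ m - (var_x + var_t) $ m * fps_X ^ (2 * c)"
    by (simp add: F_def approx2_def flip: power_mult mult.commute[of c])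
  also have "\<dots> = 0"
  proof -
    \<comment> \<open>\<open>1 + t\<close> has coefficients 1, 1, 0, 0, and so on. At
      \<open>m = 1\<close> both terms are \<open>x^(2c)\<close>; the extra equation, valid since
      \<open>c\<close> is then positive, undoes the truncated subtraction in the exponent.\<close>
    consider "m = 0" | "m = 1" "2 * c = Suc (2 * c - 1)" | "m > 1"
      using assms by linarith
    then show ?thesis
      by cases (use assms in \<open>auto simp: approx1_square_nth simp flip: power_Suc\<close>)
  qed
  finally show ?thesis .
qed

section \<open>Failure of the approximation property\<close>

lemma F_in_Brho_t:
  assumes "\<rho> > 0" "y1 \<in> carrier (Brho_t \<rho>)" "y2 \<in> carrier (Brho_t \<rho>)"
  shows "F y1 y2 \<in> carrier (Brho_t \<rho>)"
proof -
  have "var_x \<in> carrier (Brho_t \<rho>)" "- (var_x + var_t) \<in> carrier (Brho_t \<rho>)"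
    using X_power_in_Brho[of 1 \<rho>] Brho_uminus[OF X_power_in_Brho[of 1 \<rho>]] Brho_uminus[OF Brho_1]
    by (auto intro!: Brho_t_finite_support[of "{0,1}"] simp: Brho_0 split: if_splits)
  then have "var_x * (y1 * y1) + - (var_x + var_t) * (y2 * y2) \<in> carrier (Brho_t \<rho>)"
    by (intro Brho_t_add_closed Brho_t_mult_closed assms)
  also have "var_x * (y1 * y1) + - (var_x + var_t) * (y2 * y2) = F y1 y2"
    by (simp only: F_def power2_eq_square diff_conv_add_uminus mult_minus_left)
  finally show ?thesis .
qed

lemma F_approx_in_t_ideal_pow:
  assumes "\<rho> > 0"
  shows "F (approx1 c) (approx2 c) \<in> t_ideal_pow \<rho> (c + 1)"
  by (simp add: t_ideal_pow_iff[OF assms] F_in_Brho_t[OF assms] approx1_in_Brho_t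
      approx2_in_Brho_t F_approx_nth)

theorem mainTheorem2:
  fixes \<rho> :: real
  assumes "\<rho> > 0"
  shows
    "(\<forall>c. (approx1 c :: 'k::{real_normed_field,banach} fps fps) \<in> carrier (Brho_t \<rho>) \<and>
        (approx2 c :: 'k fps fps) \<in> carrier (Brho_t \<rho>) \<and>
        F (approx1 c) (approx2 c :: 'k fps fps) \<in> t_ideal_pow \<rho> (c + 1)) \<and>
     {(y1 :: 'k fps fps, y2). y1 \<in> carrier (Brho_t \<rho>) \<and> y2 \<in> carrier (Brho_t \<rho>) \<and> F y1 y2 = 0}
       = {(0, 0)} \<and>
     (\<nexists>\<beta> :: nat \<Rightarrow> nat.
        \<forall>y1 \<in> carrier (Brho_t \<rho> :: 'k fps fps ring). \<forall>y2 \<in> carrier (Brho_t \<rho>). \<forall>k.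
          F y1 y2 \<in> t_ideal_pow \<rho> (\<beta> k) \<longrightarrow>
          (\<exists>z1 \<in> carrier (Brho_t \<rho>). \<exists>z2 \<in> carrier (Brho_t \<rho>). F z1 z2 = 0 \<and>
             z1 - y1 \<in> t_ideal_pow \<rho> k \<and> z2 - y2 \<in> t_ideal_pow \<rho> k))"
proof (intro conjI allI notI)
  fix c
  show "approx1 c \<in> carrier (Brho_t \<rho>)" "approx2 c \<in> carrier (Brho_t \<rho>)"
    "F (approx1 c) (approx2 c) \<in> t_ideal_pow \<rho> (c + 1)"
    by (rule approx1_in_Brho_t approx2_in_Brho_t F_approx_in_t_ideal_pow[OF assms])+
next
  have "(0 :: 'k fps fps) \<in> carrier (Brho_t \<rho>)"
    by (rule Brho_t_finite_support[of "{}"]) (auto simp: Brho_0)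
  then show "{(y1 :: 'k fps fps, y2). y1 \<in> carrier (Brho_t \<rho>) \<and> y2 \<in> carrier (Brho_t \<rho>) \<and>
      F y1 y2 = 0} = {(0, 0)}"
    by (auto simp: F_eq_0_iff)
next
  assume "\<exists>\<beta> :: nat \<Rightarrow> nat.
    \<forall>y1 \<in> carrier (Brho_t \<rho> :: 'k fps fps ring). \<forall>y2 \<in> carrier (Brho_t \<rho>). \<forall>k.
      F y1 y2 \<in> t_ideal_pow \<rho> (\<beta> k) \<longrightarrow>
      (\<exists>z1 \<in> carrier (Brho_t \<rho>). \<exists>z2 \<in> carrier (Brho_t \<rho>). F z1 z2 = 0 \<and>
         z1 - y1 \<in> t_ideal_pow \<rho> k \<and> z2 - y2 \<in> t_ideal_pow \<rho> k)"
  then obtain \<beta> :: "nat \<Rightarrow> nat" where \<beta>: "\<And>(y1 :: 'k fps fps) y2 k.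
      y1 \<in> carrier (Brho_t \<rho>) \<Longrightarrow> y2 \<in> carrier (Brho_t \<rho>) \<Longrightarrow> F y1 y2 \<in> t_ideal_pow \<rho> (\<beta> k) \<Longrightarrow>
      \<exists>z1 z2. F z1 z2 = 0 \<and> z2 - y2 \<in> t_ideal_pow \<rho> k"
    by metis
  \<comment> \<open>Already \<open>k = 1\<close> is contradictory: at order \<open>\<beta> 1\<close>
    the approximate solution would have to agree modulo \<open>t\<close> with the zero solution,
    although \<open>x^c\<close> is nonzero modulo \<open>t\<close>.\<close>
  define c where "c = \<beta> 1"
  have "F (approx1 c) (approx2 c :: 'k fps fps) \<in> t_ideal_pow \<rho> (\<beta> 1)"
    using F_approx_in_t_ideal_pow[OF assms, of c] by (auto simp: t_ideal_pow_iff[OF assms] c_def)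
  then have "- (approx2 c :: 'k fps fps) \<in> t_ideal_pow \<rho> 1"
    using \<beta>[OF approx1_in_Brho_t approx2_in_Brho_t] by (force simp: F_eq_0_iff)
  then have "(- (approx2 c :: 'k fps fps)) $ 0 = 0"
    unfolding t_ideal_pow_iff[OF assms] by blast
  then show False
    by (simp add: approx2_def)
qed

end
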